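(* Let $F$ be a tract equipped with an involution $\tau$, let $E=\{1,\dots,n\}$, and let $(M_1,\dots,M_s)$ be a sequence of $F$-matroids on $E$ with cocircuit sets $\mathcal{C}^*(M_i)$ and covector sets $\mathcal{V}^*(M_i)$. Then the following are equivalent: (1) $(M_1,\dots,M_s)$ is a flag $F$-matroid; (2) $\mathcal{C}^*(M_i)\subseteq\mathcal{V}^*(M_j)$ for all $1\le i<j\le s$.
   Context: A tract is a commutative multiplicative monoid $F$ with identity $1$ and absorbing element $0$ such that $F^\times=F\setminus\{0\}$ is a group, together with a subset $N_F\subseteq\mathbb{N}[F^\times]$ (the nullset; $\mathbb{N}[F^\times]$ is the group semiring of finite formal sums of elements of $F^\times$) such that $0\in N_F$, $1\notin N_F$, there is a unique $\epsilon\in F^\times$ with $1+\epsilon\in N_F$, and $N_F$ is stable under multiplication by $F^\times$. (Terms equal to $0\in F$ in a sum are omitted.) A morphism of tracts $f:F\to F'$ is a multiplicative map with $f(0)=0$, $f(1)=1$ and $\sum f(a_i)\in N_{F'}$ whenever $\sum a_i\in N_F$. An involution of $F$ is a tract morphism $\tau:F\to F$ with $\tau^2=\mathrm{id}$; write $\overline{x}=\tau(x)$. A Grassmann–Plücker function of rank $r$ on $E=\{1,\dots,n\}$ with coefficients in $F$ is a map $\varphi:E^r\to F$ that is not identically zero, is alternating (swapping two arguments multiplies the value by $\epsilon$, and $\varphi(x_1,\dots,x_r)=0$ if $x_i=x_j$ for some $i\neq j$), and satisfies $\sum_{k=1}^{r+1}\epsilon^k\varphi(y_1,\dots,\widehat{y_k},\dots,y_{r+1})\varphi(y_k,x_1,\dots,x_{r-1})\in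 N_F$ for all $x_1,\dots,x_{r-1},y_1,\dots,y_{r+1}\in E$. An $F$-matroid of rank $r$ on $E$ is a class $M=[\varphi]$ of such functions modulo $\varphi\sim a\varphi$ for $a\in F^\times$. Its underlying matroid $\underline{M}$ is the usual matroid on $E$ whose bases are the sets $\{x_1,\dots,x_r\}$ with $\varphi(x_1,\dots,x_r)\neq0$. Quotients and flags: if $M=[\mu]$ and $N=[\nu]$ are $F$-matroids on $E$ of ranks $r$ and $w$, then $M$ is a quotient of $N$, written $N\twoheadrightarrow M$, if $\sum_{k=1}^{w+1}\epsilon^k\,\nu(y_1,\dots,\widehat{y_k},\dots,y_{w+1})\,\mu(y_k,x_1,\dots,x_{r-1})\in N_F$ for all $y_1,\dots,y_{w+1},x_1,\dots,x_{r-1}\in E$ (this does not depend on the representatives). A flag $F$-matroid on $E$ is a sequence $(M_1,\dots,M_s)$ of $F$-matroids on $E$ with $M_j\twoheadrightarrow M_i$ for all $1\le i<j\le s$. Circuits: for each circuit $C$ of $\underline M$ choose $y_0\in C$ and a basis $\{y_1,\dots,y_r\}$ of $\underline M$ containing $C\setminus\{y_0\}$, and define $X_C\in F^E$ by $X_C(y_i)=\epsilon^i\varphi(y_0,\dots,\widehat{y_i},\dots,y_r)$ and $X_C(y)=0$ for $y\notin\{y_0,\dots,y_r\}$. The circuit set is $\mathcal{C}(M)=\{aX_C: a\in F^\times, C\text{ a circuit of }\underline M\}$ (independent of choices). Dual: fixing the involution $\tau$, the dual $M^*$ is represented by $\varphi^*:E^{n-r}\to F$, $\varphi^*(x_1,\dots,x_{n-r})=\mathrm{sign}(x_1,\dots,x_{n-r},x'_1,\dots,x'_r)\,\overline{\varphi(x'_1,\dots,x'_r)}$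 whenever $E=\{x_1,\dots,x_{n-r},x'_1,\dots,x'_r\}$ (and $0$ otherwise), where $\mathrm{sign}$ is the sign of the permutation sorting the tuple increasingly, with $-1$ read as $\epsilon$. The cocircuits are $\mathcal{C}^*(M)=\mathcal{C}(M^* )$. For $X,Y\in F^E$, $X\cdot Y=\sum_{i\in E}X_i\overline{Y_i}\in\mathbb{N}[F^\times]$, and $X\perp Y$ if $X\cdot Y\in N_F$; for $\mathcal{X}\subseteq F^E$, $\mathcal{X}^\perp=\{Y: Y\perp X\ \forall X\in\mathcal X\}$. The covectors of $M$ are $\mathcal{V}^*(M)=\mathcal{C}(M)^\perp$. *)

theory Defs
  imports
    "HOL-Library.Multiset"
    "HOL-Library.FuncSet"
    "HOL-Combinatorics.Permutations"
begin

text \<open>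
  Elements of \<open>\<nat>[F\<^sup>\<times>]\<close> are multisets over \<open>F\<close> that do not contain \<open>0\<close>. A formal sum
  \<open>\<Sum>i\<in>I. f i\<close> of elements of \<open>F\<close> omits its zero terms.
\<close>

definition drop_zeros :: "'a::zero multiset \<Rightarrow> 'a multiset" where
  "drop_zeros S = filter_mset (\<lambda>x. x \<noteq> 0) S"

definition formal_sum :: "('i \<Rightarrow> 'a::zero) \<Rightarrow> 'i set \<Rightarrow> 'a multiset" where
  "formal_sum f I = drop_zeros (image_mset f (mset_set I))"

text \<open>
  The underlying monoid of the tract is the type \<open>'a\<close>. The first two assumptions say that
  \<open>UNIV - {0}\<close> is a group under multiplication (closure follows from them).
\<close>

locale tract =
  fixes N :: "'a::{comm_monoid_mult, mult_zero} multiset set"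
  assumes one_nonzero: "(1::'a) \<noteq> 0"
    and unit_inverse: "\<And>x::'a. x \<noteq> 0 \<Longrightarrow> \<exists>y. y \<noteq> 0 \<and> x * y = 1"
    and null_formal_sums: "\<And>S. S \<in> N \<Longrightarrow> 0 \<notin># S"
    and zero_null: "{#} \<in> N"
    and one_not_null: "{#1#} \<notin> N"
    and ex1_eps: "\<exists>!e. e \<noteq> 0 \<and> {#1, e#} \<in> N"
    and null_scale: "\<And>a S. a \<noteq> 0 \<Longrightarrow> S \<in> N \<Longrightarrow> image_mset (\<lambda>x. a * x) S \<in> N"

definition eps :: "'a::{comm_monoid_mult, mult_zero} multiset set \<Rightarrow> 'a" where
  "eps N = (THE e. e \<noteq> 0 \<and> {#1, e#} \<in> N)"

definition tract_morphism ::
  "'a::{comm_monoid_mult, mult_zero} multiset set \<Rightarrow> 'b::{comm_monoid_mult, mult_zero} multiset set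
    \<Rightarrow> ('a \<Rightarrow> 'b) \<Rightarrow> bool" where
  "tract_morphism N N' f \<longleftrightarrow>
     (\<forall>x y. f (x * y) = f x * f y) \<and> f 0 = 0 \<and> f 1 = 1 \<and>
     (\<forall>S\<in>N. drop_zeros (image_mset f S) \<in> N')"

definition tract_involution ::
  "'a::{comm_monoid_mult, mult_zero} multiset set \<Rightarrow> ('a \<Rightarrow> 'a) \<Rightarrow> bool" where
  "tract_involution N \<tau> \<longleftrightarrow> tract_morphism N N \<tau> \<and> (\<forall>x. \<tau> (\<tau> x) = x)"

text \<open>
  \<open>tuples n r\<close> is \<open>E\<^sup>r\<close> for \<open>E = {1..n}\<close>. List positions are counted from \<open>0\<close>, so the \<open>k\<close>-th entry
  of a tuple \<open>(y\<^sub>1, \<dots>)\<close> is \<open>ys ! (k - 1)\<close>. Maps on \<open>E\<^sup>r\<close> and vectors in \<open>F\<^sup>E\<close> are extensional functions.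
\<close>

definition tuples :: "nat \<Rightarrow> nat \<Rightarrow> nat list set" where
  "tuples n r = {xs. set xs \<subseteq> {1..n} \<and> length xs = r}"

definition omit :: "nat \<Rightarrow> 'b list \<Rightarrow> 'b list" where
  "omit k ys = take k ys @ drop (Suc k) ys"

text \<open>
  The relations \<open>\<Sum>k. \<epsilon>\<^sup>k \<nu>(y\<^sub>1, \<dots>, omit y\<^sub>k, \<dots>) \<mu>(y\<^sub>k, x\<^sub>1, \<dots>)\<close> common to Grassmann-Pluecker
  functions (\<open>\<nu> = \<mu>\<close>) and quotients. The tuple \<open>xs\<close> has \<open>r - 1\<close> entries; for \<open>r = 0\<close> there is no
  such tuple and hence no relation.
\<close>

definition plucker_relations ::
  "'a::{comm_monoid_mult, mult_zero} multiset set \<Rightarrow> nat \<Rightarrow>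
    nat \<Rightarrow> (nat list \<Rightarrow> 'a) \<Rightarrow> nat \<Rightarrow> (nat list \<Rightarrow> 'a) \<Rightarrow> bool" where
  "plucker_relations N n w \<nu> r \<mu> \<longleftrightarrow>
     (\<forall>ys xs. ys \<in> tuples n (Suc w) \<longrightarrow> set xs \<subseteq> {1..n} \<longrightarrow> Suc (length xs) = r \<longrightarrow>
        formal_sum (\<lambda>k. eps N ^ Suc k * \<nu> (omit k ys) * \<mu> (ys ! k # xs)) {..<Suc w} \<in> N)"

definition GP_function ::
  "'a::{comm_monoid_mult, mult_zero} multiset set \<Rightarrow> nat \<Rightarrow> nat \<Rightarrow> (nat list \<Rightarrow> 'a) \<Rightarrow> bool" where
  "GP_function N n r \<phi> \<longleftrightarrow>
     \<phi> \<in> tuples n r \<rightarrow>\<^sub>E UNIV \<and>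
     (\<exists>xs\<in>tuples n r. \<phi> xs \<noteq> 0) \<and>
     (\<forall>xs\<in>tuples n r. \<forall>i<r. \<forall>j<r. i \<noteq> j \<longrightarrow>
        \<phi> (xs[i := xs ! j, j := xs ! i]) = eps N * \<phi> xs) \<and>
     (\<forall>xs\<in>tuples n r. \<forall>i<r. \<forall>j<r. i \<noteq> j \<longrightarrow> xs ! i = xs ! j \<longrightarrow> \<phi> xs = 0) \<and>
     plucker_relations N n r \<phi> r \<phi>"

text \<open>An \<open>F\<close>-matroid is the set of all unit multiples of a Grassmann-Pluecker function.\<close>

definition scaling_class ::
  "nat \<Rightarrow> nat \<Rightarrow> (nat list \<Rightarrow> 'a::{comm_monoid_mult, mult_zero}) \<Rightarrow> (nat list \<Rightarrow> 'a) set" where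
  "scaling_class n r \<phi> = {\<lambda>xs\<in>tuples n r. a * \<phi> xs | a. a \<noteq> 0}"

definition F_matroid ::
  "'a::{comm_monoid_mult, mult_zero} multiset set \<Rightarrow> nat \<Rightarrow> nat \<Rightarrow> (nat list \<Rightarrow> 'a) set \<Rightarrow> bool" where
  "F_matroid N n r M \<longleftrightarrow> (\<exists>\<phi>. GP_function N n r \<phi> \<and> M = scaling_class n r \<phi>)"

text \<open>\<open>F_quotient N n w Q r M\<close>: the rank \<open>r\<close> matroid \<open>M\<close> is a quotient of the rank \<open>w\<close> matroid \<open>Q\<close>.\<close>

definition F_quotient ::
  "'a::{comm_monoid_mult, mult_zero} multiset set \<Rightarrow> nat \<Rightarrow>
    nat \<Rightarrow> (nat list \<Rightarrow> 'a) set \<Rightarrow> nat \<Rightarrow> (nat list \<Rightarrow> 'a) set \<Rightarrow> bool" where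
  "F_quotient N n w Q r M \<longleftrightarrow> (\<forall>\<nu>\<in>Q. \<forall>\<mu>\<in>M. plucker_relations N n w \<nu> r \<mu>)"

definition flag_F_matroid ::
  "'a::{comm_monoid_mult, mult_zero} multiset set \<Rightarrow> nat \<Rightarrow> nat \<Rightarrow>
    (nat \<Rightarrow> nat) \<Rightarrow> (nat \<Rightarrow> (nat list \<Rightarrow> 'a) set) \<Rightarrow> bool" where
  "flag_F_matroid N n s r M \<longleftrightarrow>
     (\<forall>i\<in>{1..s}. F_matroid N n (r i) (M i)) \<and>
     (\<forall>i j. 1 \<le> i \<longrightarrow> i < j \<longrightarrow> j \<le> s \<longrightarrow> F_quotient N n (r j) (M j) (r i) (M i))"

definition underlying_bases ::
  "nat \<Rightarrow> nat \<Rightarrow> (nat list \<Rightarrow> 'a::zero) set \<Rightarrow> nat set set" where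
  "underlying_bases n r M = {set xs | xs. xs \<in> tuples n r \<and> (\<exists>\<phi>\<in>M. \<phi> xs \<noteq> 0)}"

definition underlying_indep ::
  "nat \<Rightarrow> nat \<Rightarrow> (nat list \<Rightarrow> 'a::zero) set \<Rightarrow> nat set \<Rightarrow> bool" where
  "underlying_indep n r M I \<longleftrightarrow> (\<exists>B\<in>underlying_bases n r M. I \<subseteq> B)"

definition underlying_circuits ::
  "nat \<Rightarrow> nat \<Rightarrow> (nat list \<Rightarrow> 'a::zero) set \<Rightarrow> nat set set" where
  "underlying_circuits n r M =
     {C. C \<subseteq> {1..n} \<and> \<not> underlying_indep n r M C \<and> (\<forall>D. D \<subset> C \<longrightarrow> underlying_indep n r M D)}"

text \<open>For a tuple \<open>ys = (y\<^sub>0, \<dots>, y\<^sub>r)\<close> of distinct elements: \<open>y\<^sub>i \<mapsto> \<epsilon>\<^sup>i \<phi>(y\<^sub>0, \<dots>, omit y\<^sub>i, \<dots>, y\<^sub>r)\<close>.\<close>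

definition circuit_vector ::
  "'a::{comm_monoid_mult, mult_zero} multiset set \<Rightarrow> nat \<Rightarrow>
    (nat list \<Rightarrow> 'a) \<Rightarrow> nat list \<Rightarrow> (nat \<Rightarrow> 'a)" where
  "circuit_vector N n \<phi> ys =
     (\<lambda>y\<in>{1..n}. if y \<in> set ys
        then (let i = (THE i. i < length ys \<and> ys ! i = y) in eps N ^ i * \<phi> (omit i ys))
        else 0)"

text \<open>
  All choices of the representative \<open>\<phi>\<close>, the element \<open>y\<^sub>0\<close> and the ordered basis \<open>bs\<close> are admitted;
  for a fixed circuit \<open>C\<close> they lead to the same vectors up to units.
\<close>

definition F_circuits ::
  "'a::{comm_monoid_mult, mult_zero} multiset set \<Rightarrow> nat \<Rightarrow> nat \<Rightarrow>
    (nat list \<Rightarrow> 'a) set \<Rightarrow> (nat \<Rightarrow> 'a) set" where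
  "F_circuits N n r M =
     {\<lambda>y\<in>{1..n}. a * circuit_vector N n \<phi> (y0 # bs) y | a \<phi> C y0 bs.
        a \<noteq> 0 \<and> \<phi> \<in> M \<and> C \<in> underlying_circuits n r M \<and> y0 \<in> C \<and>
        bs \<in> tuples n r \<and> set bs \<in> underlying_bases n r M \<and> C - {y0} \<subseteq> set bs}"

definition tuple_sign ::
  "'a::{comm_monoid_mult, mult_zero} multiset set \<Rightarrow> nat list \<Rightarrow> 'a" where
  "tuple_sign N xs =
     (if evenperm (THE p. p permutes {..<length xs} \<and> sorted (permute_list p xs)) then 1 else eps N)"

text \<open>
  The complementary tuple \<open>(x'\<^sub>1, \<dots>, x'\<^sub>r)\<close> is taken in increasing order; as \<open>\<phi>\<close> is alternating,
  any other order gives the same value.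
\<close>

definition dual_function ::
  "'a::{comm_monoid_mult, mult_zero} multiset set \<Rightarrow> ('a \<Rightarrow> 'a) \<Rightarrow> nat \<Rightarrow> nat \<Rightarrow>
    (nat list \<Rightarrow> 'a) \<Rightarrow> (nat list \<Rightarrow> 'a)" where
  "dual_function N \<tau> n r \<phi> =
     (\<lambda>xs\<in>tuples n (n - r). if distinct xs
        then (let xs' = sorted_list_of_set ({1..n} - set xs)
              in tuple_sign N (xs @ xs') * \<tau> (\<phi> xs'))
        else 0)"

definition dual_F_matroid ::
  "'a::{comm_monoid_mult, mult_zero} multiset set \<Rightarrow> ('a \<Rightarrow> 'a) \<Rightarrow> nat \<Rightarrow> nat \<Rightarrow>
    (nat list \<Rightarrow> 'a) set \<Rightarrow> (nat list \<Rightarrow> 'a) set" where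
  "dual_F_matroid N \<tau> n r M = (\<Union>\<phi>\<in>M. scaling_class n (n - r) (dual_function N \<tau> n r \<phi>))"

definition F_cocircuits ::
  "'a::{comm_monoid_mult, mult_zero} multiset set \<Rightarrow> ('a \<Rightarrow> 'a) \<Rightarrow> nat \<Rightarrow> nat \<Rightarrow>
    (nat list \<Rightarrow> 'a) set \<Rightarrow> (nat \<Rightarrow> 'a) set" where
  "F_cocircuits N \<tau> n r M = F_circuits N n (n - r) (dual_F_matroid N \<tau> n r M)"

definition dot :: "('a \<Rightarrow> 'a) \<Rightarrow> nat \<Rightarrow> (nat \<Rightarrow> 'a) \<Rightarrow> (nat \<Rightarrow> 'a) \<Rightarrow> 'a::mult_zero multiset" where
  "dot \<tau> n X Y = formal_sum (\<lambda>i. X i * \<tau> (Y i)) {1..n}"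

definition perp ::
  "'a::mult_zero multiset set \<Rightarrow> ('a \<Rightarrow> 'a) \<Rightarrow> nat \<Rightarrow> (nat \<Rightarrow> 'a) set \<Rightarrow> (nat \<Rightarrow> 'a) set" where
  "perp N \<tau> n \<X> = {Y \<in> {1..n} \<rightarrow>\<^sub>E UNIV. \<forall>X\<in>\<X>. dot \<tau> n Y X \<in> N}"

definition F_covectors ::
  "'a::{comm_monoid_mult, mult_zero} multiset set \<Rightarrow> ('a \<Rightarrow> 'a) \<Rightarrow> nat \<Rightarrow> nat \<Rightarrow>
    (nat list \<Rightarrow> 'a) set \<Rightarrow> (nat \<Rightarrow> 'a) set" where
  "F_covectors N \<tau> n r M = perp N \<tau> n (F_circuits N n r M)"

end

theory Submission
  imports Defs
begin

text \<open>
  Up to a unit, a cocircuit of \<open>[\<mu>]\<close> is the vector \<open>y \<mapsto> \<tau>(\<mu>(y, x\<^sub>1, \<dots>, x\<^bsub>r-1\<^esub>))\<close>, where the \<open>x\<^sub>i\<close>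
  enumerate the complement of the tuple that defines it in the dual: the sign \<open>\<epsilon>\<^sup>k\<close> of the circuit
  vector cancels against the sign of moving the \<open>k\<close>-th entry into the complement. Pairing it with the
  circuit \<open>y\<^sub>k \<mapsto> \<epsilon>\<^sup>k \<nu>(y\<^sub>0, \<dots>, omit y\<^sub>k, \<dots>, y\<^sub>w)\<close> of \<open>[\<nu>]\<close> gives, up to a unit and \<open>\<tau>\<close>, the quotient
  relation for \<open>ys\<close> and \<open>xs\<close>. The relations that do not arise in this way hold for trivial reasons:
  either all their terms vanish, or they have the form \<open>a + \<epsilon> a\<close>.
\<close>

section \<open>Tuples and formal sums\<close>

text \<open>Adjacent swaps generate all rearrangements. The prefix \<open>P\<close> serves the
  induction: the head of \<open>xs\<close> joins it, the tail is rearranged by the induction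
  hypothesis, and \<open>move\<close> carries the head to its final place.\<close>

lemma adjacent_swap_invariant:
  assumes "\<And>A x y B. mset (A @ x # y # B) = m \<Longrightarrow> f (A @ x # y # B) = f (A @ y # x # B)"
    and "mset (P @ xs) = m" "mset xs = mset ys"
  shows "f (P @ xs) = f (P @ ys)"
  using assms(2,3)
proof (induction xs arbitrary: P ys)
  case (Cons x xs)
  obtain A B where ys: "ys = A @ x # B"
    using Cons.prems(2) by (metis list.set_intros(1) set_mset_mset split_list)
  have move: "mset (P @ x # A @ B) = m \<Longrightarrow> f (P @ x # A @ B) = f (P @ A @ x # B)" for P
  proof (induction A arbitrary: P)
    case (Cons a A)
    have "f (P @ x # a # A @ B) = f (P @ a # x # A @ B)"
      using Cons.prems by (intro assms(1)) simp
    also have "\<dots> = f ((P @ [a]) @ x # A @ B)"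
      by simp
    also have "\<dots> = f ((P @ [a]) @ A @ x # B)"
      using Cons.prems by (intro Cons.IH) (simp add: add_mset_commute)
    finally show ?case by simp
  qed simp
  have eq: "mset xs = mset (A @ B)"
    using Cons.prems(2) ys by simp
  have "f (P @ x # xs) = f ((P @ [x]) @ xs)"
    by simp
  also have "\<dots> = f ((P @ [x]) @ A @ B)"
    using Cons.prems(1) eq by (intro Cons.IH) simp_all
  also have "\<dots> = f (P @ A @ x # B)"
    using move[of P] Cons.prems ys by simp
  finally show ?case
    using ys by simp
qed simp

lemma omit_append_Cons [simp]: "omit (length A) (A @ x # B) = A @ B"
  by (simp add: omit_def)

lemma split_at_nth:
  assumes "k < length ys"
  obtains A B where "ys = A @ ys ! k # B" "length A = k"
  using assms id_take_nth_drop[of k ys] that[of "take k ys" "drop (Suc k) ys"] by simp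

lemma formal_sum_cong:
  assumes "\<And>i. i \<in> I \<Longrightarrow> f i = g i"
  shows "formal_sum f I = formal_sum g I"
proof (cases "finite I")
  case True
  then have "image_mset f (mset_set I) = image_mset g (mset_set I)"
    using assms by (intro image_mset_cong) simp
  then show ?thesis
    by (simp add: formal_sum_def)
qed (simp add: formal_sum_def)

lemma formal_sum_mono_neutral:
  assumes "finite I" "J \<subseteq> I" "\<And>i. i \<in> I - J \<Longrightarrow> f i = 0"
  shows "formal_sum f I = formal_sum f J"
proof -
  have "mset_set I = mset_set J + mset_set (I - J)"
    using assms(1,2) by (metis finite_Diff finite_subset Diff_disjoint Un_Diff_cancel
        mset_set_Union sup.absorb2)
  moreover have "drop_zeros (image_mset f (mset_set (I - J))) = {#}"
    using assms by (auto simp: drop_zeros_def)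
  ultimately show ?thesis
    by (simp add: formal_sum_def drop_zeros_def)
qed

lemma formal_sum_reindex:
  assumes "inj_on h I"
  shows "formal_sum f (h ` I) = formal_sum (\<lambda>i. f (h i)) I"
  using assms by (simp add: formal_sum_def flip: image_mset_mset_set) (simp add: multiset.map_comp comp_def)

lemma formal_sum_eq_empty:
  assumes "\<And>i. i \<in> I \<Longrightarrow> f i = 0"
  shows "formal_sum f I = {#}"
  using formal_sum_cong[of I f "\<lambda>_. 0"] assms
  by (auto simp: formal_sum_def drop_zeros_def)

text \<open>Since \<open>g\<close> neither creates nor destroys zeros, it commutes with dropping
  them.\<close>

lemma formal_sum_image:
  assumes "\<And>x. g x = 0 \<longleftrightarrow> x = 0"
  shows "formal_sum (\<lambda>i. g (f i)) I = image_mset g (formal_sum f I)"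
  by (simp add: formal_sum_def drop_zeros_def filter_mset_image_mset multiset.map_comp comp_def assms)

section \<open>Signs and alternating functions\<close>

text \<open>Isolates the sign behaviour from the Plucker relations, so that it can be checked for
  dual functions by a computation with signs. Adjacent swaps suffice, as they generate all
  rearrangements.\<close>

definition alternating ::
  "'a::{comm_monoid_mult, mult_zero} multiset set \<Rightarrow> nat \<Rightarrow> nat \<Rightarrow> (nat list \<Rightarrow> 'a) \<Rightarrow> bool" where
  "alternating N n r \<phi> \<longleftrightarrow>
     (\<forall>A x y B. A @ x # y # B \<in> tuples n r \<longrightarrow> \<phi> (A @ x # y # B) = eps N * \<phi> (A @ y # x # B)) \<and>
     (\<forall>xs\<in>tuples n r. \<not> distinct xs \<longrightarrow> \<phi> xs = 0)"

lemma GP_function_alternating: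
  assumes "GP_function N n r \<phi>"
  shows "alternating N n r \<phi>"
  unfolding alternating_def
proof (intro conjI allI impI ballI)
  fix A x y B assume *: "A @ x # y # B \<in> tuples n r"
  let ?xs = "A @ y # x # B"
  have "?xs \<in> tuples n r" "length A < r" "Suc (length A) < r"
    using * by (auto simp: tuples_def)
  then have "\<phi> (?xs[length A := ?xs ! Suc (length A), Suc (length A) := ?xs ! length A]) = eps N * \<phi> ?xs"
    using assms unfolding GP_function_def by (metis n_not_Suc_n)
  then show "\<phi> (A @ x # y # B) = eps N * \<phi> (A @ y # x # B)"
    by (simp add: nth_append list_update_append)
next
  fix xs assume "xs \<in> tuples n r" "\<not> distinct xs"
  then show "\<phi> xs = 0"
    using assms by (auto simp: GP_function_def distinct_conv_nth tuples_def)
qed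

text \<open>Each entry of \<open>B\<close> that \<open>x\<close> passes costs one factor
  \<open>eps N\<close>.\<close>

lemma alternating_move:
  assumes "alternating N n r \<phi>" "A @ x # B @ C \<in> tuples n r"
  shows "\<phi> (A @ x # B @ C) = eps N ^ length B * \<phi> (A @ B @ x # C)"
  using assms(2)
proof (induction B arbitrary: A)
  case (Cons b B)
  have "\<phi> (A @ x # b # B @ C) = eps N * \<phi> ((A @ [b]) @ x # B @ C)"
    using assms(1) Cons.prems by (simp add: alternating_def)
  also have "\<phi> ((A @ [b]) @ x # B @ C) = eps N ^ length B * \<phi> ((A @ [b]) @ B @ x # C)"
    using Cons.prems by (intro Cons.IH) (auto simp: tuples_def)
  finally show ?case
    by (simp add: mult.assoc)
qed simp

lemma alternating_scale:
  assumes "alternating N n r \<phi>"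
  shows "alternating N n r (\<lambda>xs\<in>tuples n r. a * \<phi> xs)"
  unfolding alternating_def
proof (intro conjI allI impI ballI)
  fix A x y B assume *: "A @ x # y # B \<in> tuples n r"
  then have "A @ y # x # B \<in> tuples n r"
    by (auto simp: tuples_def)
  moreover have "\<phi> (A @ x # y # B) = eps N * \<phi> (A @ y # x # B)"
    using assms * unfolding alternating_def by blast
  ultimately show "(\<lambda>xs\<in>tuples n r. a * \<phi> xs) (A @ x # y # B) =
      eps N * (\<lambda>xs\<in>tuples n r. a * \<phi> xs) (A @ y # x # B)"
    using * by (simp only: restrict_apply' mult.left_commute)
next
  fix xs assume "xs \<in> tuples n r" "\<not> distinct xs"
  moreover from this have "\<phi> xs = 0"
    using assms unfolding alternating_def by blast
  ultimately show "(\<lambda>xs\<in>tuples n r. a * \<phi> xs) xs = 0"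
    by simp
qed

lemma scaling_class_alternating:
  assumes "alternating N n r \<phi>" "\<psi> \<in> scaling_class n r \<phi>"
  shows "alternating N n r \<psi>"
  using assms alternating_scale by (auto simp: scaling_class_def)

text \<open>Justifies the definite description in \<open>tuple_sign\<close>: both permutations
  produce the one sorted list, and distinct entries determine their positions.\<close>

lemma sorting_permutation_unique:
  assumes "distinct xs" "p permutes {..<length xs}" "sorted (permute_list p xs)"
    "q permutes {..<length xs}" "sorted (permute_list q xs)"
  shows "p = q"
proof
  fix i
  have eq: "permute_list p xs = permute_list q xs"
    using assms by (metis mset_permute_list properties_for_sort)
  show "p i = q i"
  proof (cases "i < length xs")
    case True
    then have "xs ! p i = xs ! q i" "p i < length xs" "q i < length xs"
      using eq assms(2,4) by (metis permute_list_nth, metis lessThan_iff permutes_in_image,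
        metis lessThan_iff permutes_in_image)
    then show ?thesis
      using assms(1) nth_eq_iff_index_eq by blast
  next
    case False
    then show ?thesis
      using assms(2,4) by (simp add: permutes_def)
  qed
qed

lemma tuple_sign_eq:
  assumes "distinct xs" "p permutes {..<length xs}" "sorted (permute_list p xs)"
  shows "tuple_sign N xs = (if evenperm p then 1 else eps N)"
proof -
  have "(THE p. p permutes {..<length xs} \<and> sorted (permute_list p xs)) = p"
    using assms sorting_permutation_unique by (intro the_equality) blast+
  then show ?thesis
    by (simp add: tuple_sign_def)
qed

section \<open>Units and the element \<open>\<epsilon>\<close> of a tract\<close>

context tract
begin

abbreviation "\<epsilon> \<equiv> eps N"

lemma eps: "\<epsilon> \<noteq> 0" "{#1, \<epsilon>#} \<in> N"
  using theI'[OF ex1_eps] by (simp_all add: eps_def)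

lemma eps_unique: "e \<noteq> 0 \<Longrightarrow> {#1, e#} \<in> N \<Longrightarrow> e = \<epsilon>"
  using ex1_eps eps by blast

lemma mult_eq_0_iff' [simp]: "x * y = 0 \<longleftrightarrow> x = 0 \<or> y = (0::'a)"
proof -
  have "x = 0" if "x * y = 0" "y \<noteq> 0"
  proof -
    obtain z where "y * z = 1"
      using unit_inverse \<open>y \<noteq> 0\<close> by blast
    then have "x = x * y * z"
      by (simp add: mult.assoc)
    then show ?thesis
      using that by simp
  qed
  then show ?thesis
    by auto
qed

text \<open>Scaling the null sum 1 + \<open>\<epsilon>\<close> by the inverse \<open>e\<close> of
  \<open>\<epsilon>\<close> gives \<open>e\<close> + 1, so uniqueness of \<open>\<epsilon>\<close>
  forces \<open>e\<close> to be \<open>\<epsilon>\<close> itself.\<close>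

lemma eps_square [simp]: "\<epsilon> * \<epsilon> = 1"
proof -
  obtain e where e: "e \<noteq> 0" "\<epsilon> * e = 1"
    using unit_inverse eps by blast
  have "{#1, e#} \<in> N"
    using null_scale[OF e(1) eps(2)] e by (simp add: mult.commute add_mset_commute)
  then show ?thesis
    using eps_unique e by blast
qed

lemma eps_power_nonzero [simp]: "\<epsilon> ^ k \<noteq> 0"
  by (induction k) (use one_nonzero eps in auto)

lemma eps_power_square [simp]: "\<epsilon> ^ k * \<epsilon> ^ k = 1"
  by (simp flip: power_mult_distrib)

lemma eps_power_cancel [simp]: "\<epsilon> ^ k * (\<epsilon> ^ k * x) = x"
  by (simp flip: mult.assoc)

lemma formal_sum_scale_null_iff:
  assumes "c \<noteq> 0"
  shows "formal_sum (\<lambda>i. c * f i) I \<in> N \<longleftrightarrow> formal_sum f I \<in> N"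
proof -
  obtain d where d: "d \<noteq> 0" "c * d = 1"
    using unit_inverse assms by blast
  have eq: "formal_sum (\<lambda>i. c * f i) I = image_mset ((*) c) (formal_sum f I)"
    using assms by (intro formal_sum_image) simp
  have "d * (c * x) = x" for x
    using d by (metis mult.assoc mult.commute mult_1)
  then have "image_mset ((*) d) (image_mset ((*) c) (formal_sum f I)) = formal_sum f I"
    by (simp add: multiset.map_comp comp_def)
  then show ?thesis
    using null_scale[OF assms] null_scale[OF d(1)] eq by metis
qed

section \<open>Involutions and null sums\<close>

lemma involution_mult: "tract_involution N \<tau> \<Longrightarrow> \<tau> (x * y) = \<tau> x * \<tau> y"
  by (simp add: tract_involution_def tract_morphism_def)

lemma involution_eq_0_iff:
  assumes "tract_involution N \<tau>"
  shows "\<tau> x = 0 \<longleftrightarrow> x = 0"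
  using assms unfolding tract_involution_def tract_morphism_def by metis

lemma involution_image_null:
  assumes "tract_involution N \<tau>" "S \<in> N"
  shows "image_mset \<tau> S \<in> N"
proof -
  \<comment> \<open>\<open>\<tau>\<close> sends no unit to 0, so the zero removal built into
    \<open>tract_morphism\<close> changes nothing here.\<close>
  have "drop_zeros (image_mset \<tau> S) = image_mset \<tau> S"
    using null_formal_sums[OF assms(2)] involution_eq_0_iff[OF assms(1)]
    by (auto simp: drop_zeros_def filter_mset_eq_conv)
  then show ?thesis
    using assms unfolding tract_involution_def tract_morphism_def by metis
qed

text \<open>A morphism preserves null sums in one direction; the converse comes from applying
  \<open>\<tau>\<close> a second time.\<close>

lemma formal_sum_involution_null_iff:
  assumes "tract_involution N \<tau>"
  shows "formal_sum (\<lambda>i. \<tau> (f i)) I \<in> N \<longleftrightarrow> formal_sum f I \<in> N"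
proof -
  have eq: "formal_sum (\<lambda>i. \<tau> (f i)) I = image_mset \<tau> (formal_sum f I)"
    using assms by (intro formal_sum_image) (rule involution_eq_0_iff)
  have "image_mset \<tau> (image_mset \<tau> (formal_sum f I)) = formal_sum f I"
    using assms by (simp add: multiset.map_comp comp_def tract_involution_def)
  then show ?thesis
    using involution_image_null[OF assms] eq by metis
qed

text \<open>\<open>\<tau>\<close> maps 1 + \<open>\<epsilon>\<close> to the null sum 1 +
  \<open>\<tau> \<epsilon>\<close>, and the unit completing 1 to a null sum is unique.\<close>

lemma involution_eps:
  assumes "tract_involution N \<tau>"
  shows "\<tau> \<epsilon> = \<epsilon>"
proof (rule eps_unique)
  show "\<tau> \<epsilon> \<noteq> 0"
    using assms eps by (simp add: involution_eq_0_iff)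
  show "{#1, \<tau> \<epsilon>#} \<in> N"
    using involution_image_null[OF assms eps(2)] assms
    by (simp add: tract_involution_def tract_morphism_def)
qed

section \<open>Signs of tuples under swaps\<close>

lemma tuple_sign_nonzero [simp]: "tuple_sign N xs \<noteq> 0"
  using one_nonzero eps by (simp add: tuple_sign_def)

text \<open>If \<open>p\<close> sorts one of the two lists, then \<open>p\<close> composed with the
  transposition of the two positions sorts the other, and the parities differ.\<close>

lemma tuple_sign_swap:
  assumes "distinct (A @ x # y # B)"
  shows "tuple_sign N (A @ x # y # B) = \<epsilon> * tuple_sign N (A @ y # x # B)"
proof -
  let ?xs = "A @ y # x # B" and ?t = "Transposition.transpose (length A) (Suc (length A))"
  have t: "?t permutes {..<length ?xs}"
    by (intro permutes_swap_id) auto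
  have swap: "A @ x # y # B = permute_list ?t ?xs"
  proof (rule nth_equalityI)
    fix i assume "i < length (A @ x # y # B)"
    then show "(A @ x # y # B) ! i = permute_list ?t ?xs ! i"
      using permute_list_nth[OF t, of i]
      by (auto simp: nth_append Transposition.transpose_def nth_Cons')
  qed simp
  obtain p where p: "p permutes {..<length ?xs}" "permute_list p ?xs = sort ?xs"
    using mset_eq_permutation[of "sort ?xs" ?xs] by auto
  \<comment> \<open>Successive permutations of a list compose into one, in which the two
    transpositions cancel.\<close>
  have "permute_list (?t \<circ> p) (permute_list ?t ?xs) = permute_list (?t \<circ> (?t \<circ> p)) ?xs"
    using permute_list_compose[of "?t \<circ> p" ?xs ?t] permutes_compose[OF p(1) t] by simp
  also have "?t \<circ> (?t \<circ> p) = p"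
    by (simp flip: comp_assoc)
  finally have "permute_list (?t \<circ> p) (A @ x # y # B) = sort ?xs"
    unfolding swap p(2) .
  then have "tuple_sign N (A @ x # y # B) = (if evenperm (?t \<circ> p) then 1 else \<epsilon>)"
    using assms permutes_compose[OF p(1) t] by (intro tuple_sign_eq) auto
  moreover have "tuple_sign N ?xs = (if evenperm p then 1 else \<epsilon>)"
    using assms p by (intro tuple_sign_eq) auto
  moreover have "permutation p"
    using p(1) permutation_permutes by blast
  then have "evenperm (?t \<circ> p) \<longleftrightarrow> \<not> evenperm p"
    by (simp add: evenperm_comp evenperm_swap permutation_swap_id)
  ultimately show ?thesis
    by simp
qed

lemma tuple_sign_move:
  assumes "distinct (A @ x # B @ C)"
  shows "tuple_sign N (A @ x # B @ C) = \<epsilon> ^ length B * tuple_sign N (A @ B @ x # C)"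
  using assms
proof (induction B arbitrary: A)
  case (Cons b B)
  have "tuple_sign N (A @ x # b # B @ C) = \<epsilon> * tuple_sign N ((A @ [b]) @ x # B @ C)"
    using tuple_sign_swap[of A x b "B @ C"] Cons.prems by simp
  also have "tuple_sign N ((A @ [b]) @ x # B @ C) = \<epsilon> ^ length B * tuple_sign N ((A @ [b]) @ B @ x # C)"
    using Cons.prems by (intro Cons.IH) auto
  finally show ?case
    by (simp add: mult.assoc)
qed simp

section \<open>Duals\<close>

text \<open>A swap leaves the complement, hence the factor \<open>\<tau> (\<phi> xs')\<close>,
  unchanged; the sign rule is that of \<open>tuple_sign\<close>, whatever \<open>\<phi>\<close>
  is.\<close>

lemma dual_function_alternating: "alternating N n (n - r) (dual_function N \<tau> n r \<phi>)"
  unfolding alternating_def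
proof (intro conjI allI impI ballI)
  fix A x y B assume *: "A @ x # y # B \<in> tuples n (n - r)"
  let ?d = "dual_function N \<tau> n r \<phi>"
  have mem: "A @ y # x # B \<in> tuples n (n - r)"
    using * by (auto simp: tuples_def)
  show "?d (A @ x # y # B) = \<epsilon> * ?d (A @ y # x # B)"
  proof (cases "distinct (A @ x # y # B)")
    case True
    define xs where "xs = sorted_list_of_set ({1..n} - set (A @ x # y # B))"
    have xs': "xs = sorted_list_of_set ({1..n} - set (A @ y # x # B))"
      unfolding xs_def by (simp add: insert_commute)
    have "distinct ((A @ x # y # B) @ xs)"
      using True by (auto simp: xs_def)
    then have "tuple_sign N ((A @ x # y # B) @ xs) = \<epsilon> * tuple_sign N ((A @ y # x # B) @ xs)"
      using tuple_sign_swap[of A x y "B @ xs"] by simp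
    moreover have "?d (A @ x # y # B) = tuple_sign N ((A @ x # y # B) @ xs) * \<tau> (\<phi> xs)"
      using * True unfolding dual_function_def xs_def by (simp add: Let_def)
    moreover have "?d (A @ y # x # B) = tuple_sign N ((A @ y # x # B) @ xs) * \<tau> (\<phi> xs)"
      using mem True unfolding dual_function_def xs' by (auto simp: Let_def)
    ultimately show ?thesis
      by (simp add: mult.assoc)
  next
    case False
    then have "\<not> distinct (A @ y # x # B)"
      by auto
    then show ?thesis
      using False * mem unfolding dual_function_def by (simp only: restrict_apply' if_False mult_zero_right)
  qed
qed (simp add: dual_function_def)

text \<open>Frees the dual from the increasing order of the complement, which is needed for
  complements of the form \<open>y # xs\<close>. Swapping neighbours in the complement yields one
  \<open>\<epsilon>\<close> from the sign and one from \<open>\<phi>\<close> (fixed by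
  \<open>\<tau>\<close>), and these cancel.\<close>

lemma dual_function_eq:
  assumes \<tau>: "tract_involution N \<tau>" and \<phi>: "alternating N n r \<phi>" and "r \<le> n"
    and "zs \<in> tuples n (n - r)" "distinct zs" "distinct xs" "set xs = {1..n} - set zs"
  shows "dual_function N \<tau> n r \<phi> zs = tuple_sign N (zs @ xs) * \<tau> (\<phi> xs)"
proof -
  define f where "f L = tuple_sign N (zs @ L) * \<tau> (\<phi> L)" for L
  define ss where "ss = sorted_list_of_set ({1..n} - set zs)"
  have eq: "mset xs = mset ss"
    using assms by (simp add: ss_def set_eq_iff_mset_eq_distinct[symmetric])
  have "card (set xs) = n - (n - r)"
    using assms by (auto simp: tuples_def card_Diff_subset distinct_card)
  then have len: "length xs = r"
    using distinct_card[OF assms(6)] \<open>r \<le> n\<close> by simp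
  have "f ([] @ xs) = f ([] @ ss)"
  proof (rule adjacent_swap_invariant[where m = "mset xs"])
    fix A x y B assume *: "mset (A @ x # y # B) = mset xs"
    have mem: "A @ x # y # B \<in> tuples n r"
      using mset_eq_setD[OF *] mset_eq_length[OF *] assms len by (auto simp: tuples_def)
    have "distinct (zs @ A @ x # y # B)"
      using mset_eq_setD[OF *] mset_eq_imp_distinct_iff[OF *] assms by auto
    then have "tuple_sign N (zs @ A @ x # y # B) = \<epsilon> * tuple_sign N (zs @ A @ y # x # B)"
      using tuple_sign_swap[of "zs @ A" x y B] by simp
    moreover have "\<tau> (\<phi> (A @ x # y # B)) = \<epsilon> * \<tau> (\<phi> (A @ y # x # B))"
      using \<phi> mem involution_mult[OF \<tau>] involution_eps[OF \<tau>] by (simp add: alternating_def)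
    moreover have "\<epsilon> * a * (\<epsilon> * b) = \<epsilon> * \<epsilon> * (a * b)" for a b
      by (simp only: ac_simps)
    ultimately show "f (A @ x # y # B) = f (A @ y # x # B)"
      by (simp add: f_def)
  qed (use eq in simp_all)
  then show ?thesis
    using assms by (simp add: f_def ss_def dual_function_def Let_def)
qed

section \<open>Circuits and cocircuits\<close>

lemma circuit_vector_append_Cons:
  assumes "distinct (A @ y # B)" "y \<in> {1..n}"
  shows "circuit_vector N n \<phi> (A @ y # B) y = \<epsilon> ^ length A * \<phi> (A @ B)"
proof -
  have "(THE i. i < length (A @ y # B) \<and> (A @ y # B) ! i = y) = length A"
  proof (rule the_equality)
    fix i assume "i < length (A @ y # B) \<and> (A @ y # B) ! i = y"
    then show "i = length A"
      using assms(1) nth_eq_iff_index_eq[of "A @ y # B" i "length A"] by simp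
  qed simp
  then show ?thesis
    using assms by (simp add: circuit_vector_def)
qed

lemma circuit_vector_notin:
  assumes "y \<notin> set ys" "y \<in> {1..n}"
  shows "circuit_vector N n \<phi> ys y = 0"
  using assms by (simp add: circuit_vector_def)

text \<open>Shows that the choice of the distinguished first element matters only up to a unit. For
  \<open>y\<close> in \<open>A\<close> the position of \<open>y\<close> shifts by one while
  \<open>x\<close> passes one entry fewer; for \<open>y\<close> in \<open>B\<close> the position
  stays and \<open>x\<close> passes all of \<open>A\<close>.\<close>

lemma circuit_vector_move_front:
  assumes \<phi>: "alternating N n r \<phi>" and ys: "A @ x # B \<in> tuples n (Suc r)" "distinct (A @ x # B)"
    and y: "y \<in> {1..n}"
  shows "circuit_vector N n \<phi> (x # A @ B) y = \<epsilon> ^ length A * circuit_vector N n \<phi> (A @ x # B) y"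
proof -
  consider "y \<notin> set (A @ x # B)" | "y = x" | "y \<in> set A" | "y \<in> set B"
    by auto
  then show ?thesis
  proof cases
    case 1
    then show ?thesis
      using y by (simp add: circuit_vector_notin)
  next
    case 2
    then show ?thesis
      using y ys circuit_vector_append_Cons[of A y B] circuit_vector_append_Cons[of "[]" y "A @ B"]
      by simp
  next
    case 3
    then obtain A1 A2 where A: "A = A1 @ y # A2"
      by (meson split_list)
    have "[] @ x # (A1 @ A2) @ B \<in> tuples n r"
      using ys A by (auto simp: tuples_def)
    from alternating_move[OF \<phi> this]
    have "\<phi> (x # A1 @ A2 @ B) = \<epsilon> ^ (length A1 + length A2) * \<phi> (A1 @ A2 @ x # B)"
      by simp
    then show ?thesis
      using y ys A circuit_vector_append_Cons[of "x # A1" y "A2 @ B"]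
        circuit_vector_append_Cons[of A1 y "A2 @ x # B"]
      by (simp add: power_add ac_simps)
  next
    case 4
    then obtain B1 B2 where B: "B = B1 @ y # B2"
      by (meson split_list)
    have "[] @ x # A @ B1 @ B2 \<in> tuples n r"
      using ys B by (auto simp: tuples_def)
    from alternating_move[OF \<phi> this]
    have "\<phi> (x # A @ B1 @ B2) = \<epsilon> ^ length A * \<phi> (A @ x # B1 @ B2)"
      by simp
    then show ?thesis
      using y ys B circuit_vector_append_Cons[of "x # A @ B1" y B2]
        circuit_vector_append_Cons[of "A @ x # B1" y B2]
      by (simp add: power_add ac_simps)
  qed
qed

lemma card_underlying_basis:
  assumes "\<And>\<phi>. \<phi> \<in> M \<Longrightarrow> alternating N n r \<phi>" "S \<in> underlying_bases n r M"
  shows "card S = r"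
  using assms by (fastforce simp: underlying_bases_def alternating_def tuples_def distinct_card)

text \<open>The tuple is \<open>y0 # bs\<close>. It is distinct because a basis has \<open>r\<close>
  elements, and because \<open>y0\<close> in \<open>bs\<close> would put the whole circuit inside a
  basis.\<close>

lemma F_circuitsE:
  assumes "\<And>\<phi>. \<phi> \<in> M \<Longrightarrow> alternating N n r \<phi>" "X \<in> F_circuits N n r M"
  obtains a \<phi> ys where "a \<noteq> 0" "\<phi> \<in> M" "ys \<in> tuples n (Suc r)" "distinct ys"
    "X = (\<lambda>y\<in>{1..n}. a * circuit_vector N n \<phi> ys y)"
proof -
  obtain a \<phi> C y0 bs where *: "a \<noteq> 0" "\<phi> \<in> M" "C \<in> underlying_circuits n r M" "y0 \<in> C"
    "bs \<in> tuples n r" "set bs \<in> underlying_bases n r M" "C - {y0} \<subseteq> set bs"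
    and X: "X = (\<lambda>y\<in>{1..n}. a * circuit_vector N n \<phi> (y0 # bs) y)"
    using assms(2) unfolding F_circuits_def by blast
  have "card (set bs) = r"
    using assms(1) *(6) by (rule card_underlying_basis)
  then have "distinct bs"
    using *(5) by (simp add: tuples_def card_distinct)
  moreover have "y0 \<notin> set bs"
    using *(3,4,6,7) by (auto simp: underlying_circuits_def underlying_indep_def)
  ultimately have dist: "distinct (y0 # bs)"
    by simp
  have "C \<subseteq> {1..n}"
    using *(3) by (simp add: underlying_circuits_def)
  then have "y0 # bs \<in> tuples n (Suc r)"
    using *(4,5) by (auto simp: tuples_def)
  then show thesis
    by (rule that[OF *(1,2) _ dist X])
qed

text \<open>Partial converse to \<open>F_circuitsE\<close>: one nonzero value of
  \<open>\<phi>\<close> on an omission suffices, since it provides a basis inside \<open>ys\<close>,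
  and a circuit inside \<open>ys\<close> must contain the omitted element.\<close>

lemma F_circuitsI:
  assumes M: "\<And>\<phi>. \<phi> \<in> M \<Longrightarrow> alternating N n r \<phi>" and "a \<noteq> 0" "\<phi> \<in> M"
    and ys: "ys \<in> tuples n (Suc r)" "distinct ys" and k: "k < Suc r" "\<phi> (omit k ys) \<noteq> 0"
  shows "(\<lambda>y\<in>{1..n}. a * circuit_vector N n \<phi> ys y) \<in> F_circuits N n r M"
proof -
  have "k < length ys"
    using ys k by (simp add: tuples_def)
  then obtain A B where split: "ys = A @ ys ! k # B" "length A = k"
    by (rule split_at_nth)
  define x where "x = ys ! k"
  have ys_eq: "ys = A @ x # B"
    using split by (simp add: x_def)
  have AB: "A @ B \<in> tuples n r" "\<phi> (A @ B) \<noteq> 0"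
    using ys k ys_eq split(2) by (auto simp: tuples_def)
  then have basis: "set (A @ B) \<in> underlying_bases n r M"
    using \<open>\<phi> \<in> M\<close> unfolding underlying_bases_def by blast
  have dep: "\<not> underlying_indep n r M (set ys)"
  proof
    assume "underlying_indep n r M (set ys)"
    then obtain S where S: "S \<in> underlying_bases n r M" "set ys \<subseteq> S"
      by (auto simp: underlying_indep_def)
    have "card S = r"
      using M S(1) by (rule card_underlying_basis)
    moreover have "finite S"
      using S(1) by (auto simp: underlying_bases_def)
    ultimately have "card (set ys) \<le> r"
      using S(2) card_mono by blast
    then show False
      using ys by (simp add: tuples_def distinct_card)
  qed
  \<comment> \<open>A dependent subset of least cardinality is in particular minimal under
    inclusion.\<close>
  obtain C where C: "C \<subseteq> set ys" "\<not> underlying_indep n r M C"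
    and min: "\<And>D. D \<subseteq> set ys \<Longrightarrow> \<not> underlying_indep n r M D \<Longrightarrow> card C \<le> card D"
    using ex_has_least_nat[of "\<lambda>C. C \<subseteq> set ys \<and> \<not> underlying_indep n r M C" "set ys" card] dep
    by (metis order_refl)
  have "underlying_indep n r M D" if "D \<subset> C" for D
  proof (rule ccontr)
    assume "\<not> underlying_indep n r M D"
    then have "card C \<le> card D"
      using that C(1) by (intro min) auto
    moreover have "card D < card C"
      using that C(1) by (meson List.finite_set finite_subset psubset_card_mono)
    ultimately show False
      by simp
  qed
  then have circ: "C \<in> underlying_circuits n r M"
    using C ys by (auto simp: underlying_circuits_def tuples_def)
  \<comment> \<open>Without \<open>x\<close>, the set \<open>C\<close> would lie in the basis
    \<open>set (A @ B)\<close>.\<close>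
  have "x \<in> C"
    using C basis ys_eq by (auto simp: underlying_indep_def)
  moreover have "C - {x} \<subseteq> set (A @ B)"
    using C ys_eq by auto
  \<comment> \<open>The extra power of \<open>\<epsilon>\<close> compensates for moving
    \<open>x\<close> to the front.\<close>
  moreover have "a * \<epsilon> ^ length A \<noteq> 0"
    using \<open>a \<noteq> 0\<close> by simp
  ultimately have "(\<lambda>y\<in>{1..n}. a * \<epsilon> ^ length A * circuit_vector N n \<phi> (x # A @ B) y) \<in> F_circuits N n r M"
    unfolding F_circuits_def using \<open>\<phi> \<in> M\<close> circ AB basis by blast
  moreover have "a * \<epsilon> ^ length A * circuit_vector N n \<phi> (x # A @ B) y = a * circuit_vector N n \<phi> ys y"
    if "y \<in> {1..n}" for y
    using circuit_vector_move_front[OF M[OF \<open>\<phi> \<in> M\<close>], of A x B y] ys ys_eq that by (simp add: mult.assoc)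
  ultimately show ?thesis
    by (simp cong: restrict_cong)
qed

text \<open>The position of \<open>y\<close> in \<open>zs\<close> contributes
  \<open>\<epsilon> ^ length A\<close>, and moving \<open>y\<close> past \<open>B\<close> into the
  complement contributes \<open>\<epsilon> ^ length B\<close>. The total exponent is n - r for every
  \<open>y\<close>, so the factor on the right is constant. For \<open>y\<close> outside
  \<open>zs\<close> both sides vanish, as \<open>y # xs\<close> has a repetition.\<close>

lemma dual_circuit_vector:
  assumes \<tau>: "tract_involution N \<tau>" and \<phi>: "alternating N n r \<phi>" and "r \<le> n"
    and zs: "zs \<in> tuples n (Suc (n - r))" "distinct zs"
    and xs: "distinct xs" "set xs = {1..n} - set zs" and y: "y \<in> {1..n}"
  shows "circuit_vector N n (dual_function N \<tau> n r \<phi>) zs y =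
    \<epsilon> ^ (n - r) * tuple_sign N (zs @ xs) * \<tau> (\<phi> (y # xs))"
proof (cases "y \<in> set zs")
  case True
  then obtain A B where zs_eq: "zs = A @ y # B"
    by (meson split_list)
  have len: "length A + length B = n - r"
    using zs zs_eq by (simp add: tuples_def)
  have "dual_function N \<tau> n r \<phi> (A @ B) = tuple_sign N ((A @ B) @ y # xs) * \<tau> (\<phi> (y # xs))"
    using zs zs_eq xs y by (intro dual_function_eq \<tau> \<phi> \<open>r \<le> n\<close>) (auto simp: tuples_def)
  moreover have "tuple_sign N (zs @ xs) = \<epsilon> ^ length B * tuple_sign N ((A @ B) @ y # xs)"
    using tuple_sign_move[of A y B xs] zs_eq zs xs by auto
  ultimately show ?thesis
    using circuit_vector_append_Cons[of A y B] zs zs_eq y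
    by (simp add: mult.assoc power_add flip: len)
next
  case False
  have "card (set xs) = n - Suc (n - r)"
    using zs xs by (auto simp: tuples_def card_Diff_subset distinct_card)
  \<comment> \<open>This excludes r = 0, where \<open>zs\<close> would have n + 1 distinct entries,
    and so makes the truncated subtraction exact.\<close>
  moreover have "card (set zs) \<le> n"
    using zs card_mono[of "{1..n}" "set zs"] by (simp add: tuples_def)
  ultimately have "Suc (length xs) = r"
    using \<open>r \<le> n\<close> zs distinct_card[OF zs(2)] distinct_card[OF xs(1)] by (simp add: tuples_def)
  then have "y # xs \<in> tuples n r"
    using xs y by (auto simp: tuples_def)
  moreover have "\<not> distinct (y # xs)"
    using False xs y by auto
  ultimately have "\<phi> (y # xs) = 0"
    using \<phi> by (simp add: alternating_def)
  then show ?thesis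
    using False y \<tau> by (simp add: circuit_vector_notin involution_eq_0_iff)
qed

text \<open>The bridge between orthogonality and relations: \<open>ys\<close> is the tuple of the
  circuit, \<open>xs\<close> that of the cocircuit.\<close>

lemma dot_circuit_null_iff:
  assumes \<tau>: "tract_involution N \<tau>" and ys: "ys \<in> tuples n (Suc w)" "distinct ys"
    and "a \<noteq> 0" "c \<noteq> 0" and Y: "\<And>y. y \<in> {1..n} \<Longrightarrow> Y y = c * \<tau> (\<mu> (y # xs))"
  shows "dot \<tau> n Y (\<lambda>y\<in>{1..n}. a * circuit_vector N n \<nu> ys y) \<in> N \<longleftrightarrow>
    formal_sum (\<lambda>k. \<epsilon> ^ Suc k * \<nu> (omit k ys) * \<mu> (ys ! k # xs)) {..<Suc w} \<in> N"
    (is "?dot \<in> N \<longleftrightarrow> _")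
proof -
  let ?X = "circuit_vector N n \<nu> ys"
  have len: "length ys = Suc w" and sub: "set ys \<subseteq> {1..n}"
    using ys by (auto simp: tuples_def)
  have X: "?X (ys ! k) = \<epsilon> ^ k * \<nu> (omit k ys)" if "k < Suc w" for k
  proof -
    have "k < length ys"
      using that len by simp
    then obtain A B where split: "ys = A @ ys ! k # B" "length A = k"
      by (rule split_at_nth)
    have "ys ! k \<in> {1..n}"
      using sub len that nth_mem[of k ys] by (simp add: subset_eq)
    then have "circuit_vector N n \<nu> (A @ ys ! k # B) (ys ! k) = \<epsilon> ^ length A * \<nu> (A @ B)"
      using ys split(1) by (intro circuit_vector_append_Cons) simp_all
    moreover have "omit k ys = A @ B"
      using omit_append_Cons[of A "ys ! k" B] split by simp
    ultimately show ?thesis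
      using split by simp
  qed
  \<comment> \<open>\<open>dot\<close> applies \<open>\<tau>\<close> to the circuit and
    \<open>Y\<close> already carries it on \<open>\<mu>\<close>, so each term is a fixed unit times
    \<open>\<tau>\<close> of a plain product.\<close>
  have "?dot = formal_sum (\<lambda>y. c * \<tau> a * \<tau> (?X y * \<mu> (y # xs))) {1..n}"
    unfolding dot_def by (intro formal_sum_cong) (simp add: Y involution_mult[OF \<tau>] ac_simps)
  then have "?dot \<in> N \<longleftrightarrow> formal_sum (\<lambda>y. \<tau> (?X y * \<mu> (y # xs))) {1..n} \<in> N"
    using assms by (simp only:) (rule formal_sum_scale_null_iff, simp add: involution_eq_0_iff)
  also have "\<dots> \<longleftrightarrow> formal_sum (\<lambda>y. ?X y * \<mu> (y # xs)) {1..n} \<in> N"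
    by (rule formal_sum_involution_null_iff[OF \<tau>])
  also have "formal_sum (\<lambda>y. ?X y * \<mu> (y # xs)) {1..n} = formal_sum (\<lambda>y. ?X y * \<mu> (y # xs)) (set ys)"
    using sub by (intro formal_sum_mono_neutral) (auto simp: circuit_vector_notin)
  also have "set ys = (!) ys ` {..<Suc w}"
    by (auto simp: set_conv_nth len)
  also have "formal_sum (\<lambda>y. ?X y * \<mu> (y # xs)) ((!) ys ` {..<Suc w}) =
      formal_sum (\<lambda>k. ?X (ys ! k) * \<mu> (ys ! k # xs)) {..<Suc w}"
    using ys len by (intro formal_sum_reindex) (auto simp: inj_on_def nth_eq_iff_index_eq)
  also have "\<dots> = formal_sum (\<lambda>k. \<epsilon> ^ k * \<nu> (omit k ys) * \<mu> (ys ! k # xs)) {..<Suc w}"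
    by (intro formal_sum_cong) (simp add: X)
  \<comment> \<open>Circuit vectors have exponent k at list position k, the relations have
    \<open>Suc k\<close>; a global factor \<open>\<epsilon>\<close> bridges the gap.\<close>
  also have "\<dots> \<in> N \<longleftrightarrow> formal_sum (\<lambda>k. \<epsilon> * (\<epsilon> ^ k * \<nu> (omit k ys) * \<mu> (ys ! k # xs))) {..<Suc w} \<in> N"
    using eps by (intro formal_sum_scale_null_iff[symmetric])
  finally show ?thesis
    by (simp only: power_Suc mult.assoc)
qed

section \<open>Quotients\<close>

text \<open>Omitting a position other than those of two equal entries leaves a repetition, so at
  most two terms survive. They have the form a and \<open>\<epsilon>\<close> times a, whatever
  \<open>g\<close> is.\<close>

lemma plucker_sum_repeated_null:
  assumes \<nu>: "alternating N n w \<nu>" and ys: "ys \<in> tuples n (Suc w)" "\<not> distinct ys"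
  shows "formal_sum (\<lambda>k. \<epsilon> ^ Suc k * \<nu> (omit k ys) * g (ys ! k)) {..<Suc w} \<in> N"
    (is "formal_sum ?f _ \<in> N")
proof -
  obtain A x B C where ys_eq: "ys = A @ x # B @ x # C"
    using not_distinct_decomp[OF ys(2)] by auto
  let ?i = "length A" and ?j = "Suc (length A + length B)"
  have "\<nu> (omit k ys) = 0" if k: "k < Suc w" "k \<noteq> ?i" "k \<noteq> ?j" for k
  proof -
    have "k < length ys"
      using k ys by (simp add: tuples_def)
    then obtain A' B' where split: "ys = A' @ ys ! k # B'" "length A' = k"
      by (rule split_at_nth)
    have "omit k ys = A' @ B'"
      using omit_append_Cons[of A' "ys ! k" B'] split by simp
    moreover have "\<not> distinct (A' @ B')"
    proof
      assume d: "distinct (A' @ B')"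
      \<comment> \<open>\<open>h\<close> is where position i of \<open>ys\<close> ends up once
        position \<open>k\<close> is removed; being strictly increasing away from \<open>k\<close>,
        it keeps the two equal entries apart.\<close>
      define h where "h i = (if i < k then i else i - 1)" for i
      have h: "(A' @ B') ! h i = ys ! i" "h i < length (A' @ B')" if "i < length ys" "i \<noteq> k" for i
      proof -
        have len: "length ys = Suc (length A' + length B')"
          by (subst split(1)) simp
        have "(A' @ ys ! k # B') ! i = (A' @ B') ! h i"
          using that(2) split(2) by (auto simp: h_def nth_append nth_Cons')
        then show "(A' @ B') ! h i = ys ! i"
          using split(1) by simp
        show "h i < length (A' @ B')"
          using that len split(2) by (auto simp: h_def)
      qed
      have ij: "?i < length ys" "?j < length ys" "ys ! ?i = x" "ys ! ?j = x"
        by (simp_all add: ys_eq nth_append)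
      have "(A' @ B') ! h ?i = (A' @ B') ! h ?j"
        using h(1)[OF ij(1)] h(1)[OF ij(2)] k(2,3) ij(3,4) by simp
      then have "h ?i = h ?j"
        using nth_eq_iff_index_eq[OF d h(2)[OF ij(1)] h(2)[OF ij(2)]] k(2,3) by simp
      moreover have "h i < h j" if "i < j" "i \<noteq> k" "j \<noteq> k" for i j
        using that by (auto simp: h_def)
      then have "h ?i < h ?j"
        using k(2,3) by simp
      ultimately show False
        by simp
    qed
    moreover have "A' @ B' \<in> tuples n w"
      using ys(1) by (subst (asm) split(1)) (auto simp: tuples_def)
    ultimately show ?thesis
      using \<nu> by (simp add: alternating_def)
  qed
  moreover have ij: "?i < Suc w" "?j < Suc w" "?i \<noteq> ?j"
    using ys(1) ys_eq by (auto simp: tuples_def)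
  ultimately have "formal_sum ?f {..<Suc w} = formal_sum ?f {?i, ?j}"
    by (intro formal_sum_mono_neutral) auto
  also have "formal_sum ?f {?i, ?j} = formal_sum (\<lambda>k. ?f ?i * (if k = ?i then 1 else \<epsilon>)) {?i, ?j}"
  proof (rule formal_sum_cong)
    fix k assume k: "k \<in> {?i, ?j}"
    have "A @ x # B @ C \<in> tuples n w"
      using ys(1) ys_eq by (auto simp: tuples_def)
    from alternating_move[OF \<nu> this]
    have *: "\<nu> (A @ x # B @ C) = \<epsilon> ^ length B * \<nu> (A @ B @ x # C)" .
    have oi: "omit ?i ys = A @ B @ x # C" and oj: "omit ?j ys = A @ x # B @ C"
      using omit_append_Cons[of A x "B @ x # C"] omit_append_Cons[of "A @ x # B" x C]
      by (simp_all add: ys_eq)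
    have y: "ys ! ?i = x" "ys ! ?j = x"
      by (simp_all add: ys_eq nth_append)
    \<comment> \<open>The exponents differ by \<open>length B\<close> + 1 and moving
      \<open>x\<close> past \<open>B\<close> costs another \<open>length B\<close>, which leaves one
      \<open>\<epsilon>\<close>.\<close>
    have "?f ?j = ?f ?i * \<epsilon>"
      unfolding oi oj y * by (simp add: power_add ac_simps)
    then show "?f k = ?f ?i * (if k = ?i then 1 else \<epsilon>)"
      using k by auto
  qed
  also have "\<dots> \<in> N"
  proof (cases "?f ?i = 0")
    case True
    then show ?thesis
      using zero_null by (subst formal_sum_eq_empty) simp_all
  next
    case False
    have "formal_sum (\<lambda>k. if k = ?i then 1 else \<epsilon>) {?i, ?j} = {#1, \<epsilon>#}"
      using ij(3) eps one_nonzero by (simp add: formal_sum_def drop_zeros_def)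
    then show ?thesis
      using formal_sum_scale_null_iff[OF False] eps(2) by metis
  qed
  finally show ?thesis .
qed

text \<open>The theorem for a single pair. Forwards, every circuit and cocircuit comes from tuples
  to which a quotient relation applies; backwards, a nonzero term of a relation with distinct
  \<open>ys\<close> certifies both vectors at once.\<close>

lemma F_quotient_iff_cocircuits:
  assumes \<tau>: "tract_involution N \<tau>" and Q: "F_matroid N n w Q" and M: "F_matroid N n r M"
  shows "F_quotient N n w Q r M \<longleftrightarrow> F_cocircuits N \<tau> n r M \<subseteq> F_covectors N \<tau> n w Q"
proof -
  have altQ: "alternating N n w \<nu>" if "\<nu> \<in> Q" for \<nu>
    using Q that GP_function_alternating scaling_class_alternating unfolding F_matroid_def by metis
  have altM: "alternating N n r \<mu>" if "\<mu> \<in> M" for \<mu>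
    using M that GP_function_alternating scaling_class_alternating unfolding F_matroid_def by metis
  have altD: "alternating N n (n - r) \<psi>" if "\<psi> \<in> dual_F_matroid N \<tau> n r M" for \<psi>
    using that dual_function_alternating scaling_class_alternating unfolding dual_F_matroid_def by blast
  obtain \<phi> xs where \<phi>: "GP_function N n r \<phi>" "xs \<in> tuples n r" "\<phi> xs \<noteq> 0"
    using M by (auto simp: F_matroid_def GP_function_def)
  then have "distinct xs"
    using GP_function_alternating unfolding alternating_def by blast
  \<comment> \<open>A nonzero value of \<open>\<phi>\<close> needs \<open>r\<close> distinct
    elements of \<open>{1..n}\<close>; hence n - r is a true difference below.\<close>
  then have "r \<le> n"
    using \<phi>(2) card_mono[of "{1..n}" "set xs"] by (simp add: tuples_def distinct_card)
  show ?thesis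
  proof
    assume quot: "F_quotient N n w Q r M"
    show "F_cocircuits N \<tau> n r M \<subseteq> F_covectors N \<tau> n w Q"
    proof
      fix Y assume "Y \<in> F_cocircuits N \<tau> n r M"
      then have "Y \<in> F_circuits N n (n - r) (dual_F_matroid N \<tau> n r M)"
        by (simp add: F_cocircuits_def)
      with altD obtain a \<psi> zs where a: "a \<noteq> 0" "\<psi> \<in> dual_F_matroid N \<tau> n r M"
        and zs: "zs \<in> tuples n (Suc (n - r))" "distinct zs"
        and Y: "Y = (\<lambda>y\<in>{1..n}. a * circuit_vector N n \<psi> zs y)"
        by (rule F_circuitsE)
      obtain b \<mu> where b: "b \<noteq> 0" "\<mu> \<in> M"
        and \<psi>: "\<psi> = (\<lambda>xs\<in>tuples n (n - r). b * dual_function N \<tau> n r \<mu> xs)"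
        using a(2) by (auto simp: dual_F_matroid_def scaling_class_def)
      define xs where "xs = sorted_list_of_set ({1..n} - set zs)"
      have xs: "distinct xs" "set xs = {1..n} - set zs"
        by (simp_all add: xs_def)
      have "length zs \<le> n"
        using zs card_mono[of "{1..n}" "set zs"] by (simp add: tuples_def distinct_card)
      moreover have "length xs = n - length zs"
        using zs by (simp add: xs_def tuples_def card_Diff_subset distinct_card)
      ultimately have len: "Suc (length xs) = r"
        using zs \<open>r \<le> n\<close> by (simp add: tuples_def)
      have cv: "circuit_vector N n \<psi> zs y = b * circuit_vector N n (dual_function N \<tau> n r \<mu>) zs y"
        if "y \<in> {1..n}" for y
      proof (cases "y \<in> set zs")
        case True
        then obtain A B where zs_eq: "zs = A @ y # B"
          by (meson split_list)
        then have "A @ B \<in> tuples n (n - r)"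
          using zs by (auto simp: tuples_def)
        then show ?thesis
          using zs zs_eq that by (simp add: circuit_vector_append_Cons \<psi> mult.left_commute)
      qed (use that in \<open>simp add: circuit_vector_notin\<close>)
      \<comment> \<open>This unit does not depend on \<open>y\<close>, so it can be pulled out of
        the pairing.\<close>
      define c where "c = a * b * (\<epsilon> ^ (n - r) * tuple_sign N (zs @ xs))"
      have Yc: "Y y = c * \<tau> (\<mu> (y # xs))" if "y \<in> {1..n}" for y
        using dual_circuit_vector[OF \<tau> altM[OF b(2)] \<open>r \<le> n\<close> zs xs that] that cv[OF that]
        by (simp add: Y c_def mult.assoc)
      have "dot \<tau> n Y X \<in> N" if X: "X \<in> F_circuits N n w Q" for X
      proof -
        from altQ X obtain d \<nu> ys where d: "d \<noteq> 0" "\<nu> \<in> Q" "ys \<in> tuples n (Suc w)" "distinct ys"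
          and X_eq: "X = (\<lambda>y\<in>{1..n}. d * circuit_vector N n \<nu> ys y)"
          by (rule F_circuitsE)
        have "formal_sum (\<lambda>k. \<epsilon> ^ Suc k * \<nu> (omit k ys) * \<mu> (ys ! k # xs)) {..<Suc w} \<in> N"
          using quot d b xs len unfolding F_quotient_def plucker_relations_def by blast
        moreover have "c \<noteq> 0"
          using a b by (simp add: c_def)
        ultimately show ?thesis
          unfolding X_eq using dot_circuit_null_iff[OF \<tau> d(3,4,1), of c Y \<mu> xs \<nu>] Yc by simp
      qed
      moreover have "Y \<in> {1..n} \<rightarrow>\<^sub>E UNIV"
        by (auto simp: Y)
      ultimately show "Y \<in> F_covectors N \<tau> n w Q"
        by (simp add: F_covectors_def perp_def)
    qed
  next
    assume sub: "F_cocircuits N \<tau> n r M \<subseteq> F_covectors N \<tau> n w Q"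
    show "F_quotient N n w Q r M"
      unfolding F_quotient_def plucker_relations_def
    proof (intro ballI allI impI)
      fix \<nu> \<mu> ys xs
      assume \<nu>: "\<nu> \<in> Q" and \<mu>: "\<mu> \<in> M" and ys: "ys \<in> tuples n (Suc w)"
        and xs: "set xs \<subseteq> {1..n}" "Suc (length xs) = r"
      let ?S = "formal_sum (\<lambda>k. \<epsilon> ^ Suc k * \<nu> (omit k ys) * \<mu> (ys ! k # xs)) {..<Suc w}"
      have mem: "y # xs \<in> tuples n r" if "y \<in> {1..n}" for y
        using that xs by (simp add: tuples_def)
      \<comment> \<open>In the last case, \<open>\<nu> (omit k ys)\<close> being nonzero makes
        \<open>ys\<close> define a circuit, and \<open>\<mu> (ys ! k # xs)\<close> being nonzero
        makes the complement of \<open>xs\<close> define a cocircuit.\<close>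
      consider (rep) "\<not> distinct ys" | (zero) "\<And>k. k < Suc w \<Longrightarrow> \<nu> (omit k ys) * \<mu> (ys ! k # xs) = 0"
        | (nonzero) k where "distinct ys" "k < Suc w" "\<nu> (omit k ys) \<noteq> 0" "\<mu> (ys ! k # xs) \<noteq> 0"
        by force
      then show "?S \<in> N"
      proof cases
        case rep
        then show ?thesis
          by (rule plucker_sum_repeated_null[OF altQ[OF \<nu>] ys])
      next
        case zero
        then have "?S = {#}"
          by (intro formal_sum_eq_empty) (simp add: mult.assoc)
        then show ?thesis
          using zero_null by simp
      next
        case nonzero
        define z where "z = ys ! k"
        have z: "z \<in> {1..n}" "\<mu> (z # xs) \<noteq> 0"
          using nonzero ys nth_mem[of k ys] by (auto simp: tuples_def z_def subset_eq)
        have "distinct (z # xs)"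
          using altM[OF \<mu>] mem[OF z(1)] z(2) unfolding alternating_def by blast
        then have dist: "distinct xs" "z \<notin> set xs"
          by simp_all
        define zs where "zs = sorted_list_of_set ({1..n} - set xs)"
        have zs: "zs \<in> tuples n (Suc (n - r))" "distinct zs" "set xs = {1..n} - set zs"
          using xs dist \<open>r \<le> n\<close> by (auto simp: zs_def tuples_def card_Diff_subset distinct_card)
        let ?\<psi> = "dual_function N \<tau> n r \<mu>"
        have \<psi>: "?\<psi> \<in> dual_F_matroid N \<tau> n r M"
        proof -
          \<comment> \<open>The dual function is extensional, so scaling by 1 gives it back and it
            belongs to its own class.\<close>
          have "?\<psi> = (\<lambda>xs\<in>tuples n (n - r). 1 * ?\<psi> xs)"
            by (auto simp: dual_function_def fun_eq_iff)
          then show ?thesis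
            using \<mu> one_nonzero unfolding dual_F_matroid_def scaling_class_def by blast
        qed
        define c where "c = \<epsilon> ^ (n - r) * tuple_sign N (zs @ xs)"
        have c: "c \<noteq> 0"
          by (simp add: c_def)
        define Y where "Y = (\<lambda>y\<in>{1..n}. 1 * circuit_vector N n ?\<psi> zs y)"
        have Yc: "Y y = c * \<tau> (\<mu> (y # xs))" if "y \<in> {1..n}" for y
          using dual_circuit_vector[OF \<tau> altM[OF \<mu>] \<open>r \<le> n\<close> zs(1,2) dist(1) zs(3) that] that
          by (simp add: Y_def c_def)
        have "z \<in> set zs"
          using z(1) dist(2) by (simp add: zs_def)
        then obtain A B where zs_eq: "zs = A @ z # B"
          by (meson split_list)
        \<comment> \<open>The entry at \<open>z\<close> is, up to a unit, the dual function with
          \<open>z\<close> omitted from \<open>zs\<close>; this is the nonzero value that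
          \<open>F_circuitsI\<close> requires.\<close>
        have "Y z \<noteq> 0"
          using Yc z c \<tau> by (simp add: involution_eq_0_iff)
        then have "?\<psi> (omit (length A) zs) \<noteq> 0"
          using z(1) zs(2) by (auto simp: Y_def zs_eq circuit_vector_append_Cons)
        then have "Y \<in> F_cocircuits N \<tau> n r M"
          unfolding F_cocircuits_def Y_def using zs zs_eq one_nonzero \<psi> altD
          by (intro F_circuitsI[where k = "length A"]) (auto simp: tuples_def)
        moreover have "(\<lambda>y\<in>{1..n}. 1 * circuit_vector N n \<nu> ys y) \<in> F_circuits N n w Q"
          using altQ \<nu> ys nonzero one_nonzero by (intro F_circuitsI[where k = k]) auto
        ultimately have "dot \<tau> n Y (\<lambda>y\<in>{1..n}. 1 * circuit_vector N n \<nu> ys y) \<in> N"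
          using sub unfolding F_covectors_def perp_def by blast
        then show ?thesis
          using dot_circuit_null_iff[OF \<tau> ys nonzero(1) one_nonzero c, of Y \<mu> xs \<nu>] Yc by simp
      qed
    qed
  qed
qed

end

theorem theorem2p4:
  fixes N :: "'a::{comm_monoid_mult, mult_zero} multiset set"
    and \<tau> :: "'a \<Rightarrow> 'a"
    and n s :: nat
    and r :: "nat \<Rightarrow> nat"
    and M :: "nat \<Rightarrow> (nat list \<Rightarrow> 'a) set"
  assumes "tract N"
    and "tract_involution N \<tau>"
    and "\<And>i. 1 \<le> i \<Longrightarrow> i \<le> s \<Longrightarrow> F_matroid N n (r i) (M i)"
  shows "flag_F_matroid N n s r M \<longleftrightarrow>
    (\<forall>i j. 1 \<le> i \<longrightarrow> i < j \<longrightarrow> j \<le> s \<longrightarrow>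
      F_cocircuits N \<tau> n (r i) (M i) \<subseteq> F_covectors N \<tau> n (r j) (M j))"
proof -
  \<comment> \<open>Both conditions range over the same pairs i < j, so they can be compared pair by
    pair.\<close>
  have "F_quotient N n (r j) (M j) (r i) (M i) \<longleftrightarrow>
      F_cocircuits N \<tau> n (r i) (M i) \<subseteq> F_covectors N \<tau> n (r j) (M j)"
    if "1 \<le> i" "i < j" "j \<le> s" for i j
    using that assms by (intro tract.F_quotient_iff_cocircuits) auto
  then show ?thesis
    using assms(3) by (auto simp: flag_F_matroid_def)
qed

end
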